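(* The map \[\mu\colon V^{11}_1\times V^1_{11}\to\mathfrak{gl}(T),\qquad\mu(a,b)=c_1(a,b)-2c_2(a,b),\] is the moment map for the action of $\mathrm{GL}(T)$ on $V^{11}_1\times V^1_{11}$ relative to the symplectic form \[\omega_{a,b}((v,w),(v',w'))=\langle v,w'\rangle-\langle v',w\rangle,\] and it satisfies \[\langle\mu(a,b),X\rangle=\langle Xa,b\rangle,\qquad a\in V^{11}_1,\ b\in V^1_{11},\ X\in\mathfrak{gl}(T).\]
   Context: Let $T=\mathbb{R}^n$ with standard basis $e_1,\dots,e_n$ and dual basis $e^1,\dots,e^n$; repeated indices are summed. $V^{11}_1\subset T^*\otimes\operatorname{End}T$ is the space of linear maps $a\colon T\to\operatorname{End}(T)$, written $a=e^i\otimes a_i$ with $a_i=a(e_i)$, such that $a(v)w=-a(w)v$ and $\operatorname{tr}a(v)=0$ for all $v,w\in T$. Dually, identifying $\operatorname{End}(T^* )$ with $\operatorname{End}(T)$ via transposition, $V^1_{11}\subset T\otimes\operatorname{End}T$ is the space of linear maps $b\colon T^*\to\operatorname{End}(T)$, written $b=e_i\otimes b_i$ with $b_i=b(e^i)$, such that ${}^tb(\alpha)\beta=-{}^tb(\beta)\alpha$ and $\operatorname{tr}b(\alpha)=0$ for all $\alpha,\beta\in T^*$. The natural duality $\langle\cdot,\cdot\rangle\colon V^{11}_1\times V^1_{11}\to\mathbb{R}$ is $\langle a,b\rangle=\sum_i\operatorname{tr}(a_i\circ b_i)$. On $\mathfrak{gl}(T)$ the pairing is $\langle A,X\rangle=\operatorname{tr}(AX)$,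 which identifies $\mathfrak{gl}(T)$ with its dual. $\mathrm{GL}(T)$ acts naturally on all tensor spaces (on $T^*$ by $g\alpha={}^tg^{-1}\alpha$, on $\operatorname{End}T$ by conjugation), hence on $V^{11}_1$ and $V^1_{11}$, and diagonally on the product; $Xa$, $Xb$ denote the induced infinitesimal actions of $X\in\mathfrak{gl}(T)$. The contractions $c_1,c_2$ are $c_1(e^i\otimes a_i,e_j\otimes b_j)=\sum_i a_i\circ b_i$ and $c_2(e^i\otimes a_i,e_j\otimes b_j)=\sum_i b_i\circ a_i$. Moment map means: $\mu$ is $\mathrm{GL}(T)$-equivariant and $\langle d\mu_{a,b}(v,w),X\rangle=\omega_{a,b}((Xa,Xb),(v,w))$ for all $a,v\in V^{11}_1$, $b,w\in V^1_{11}$, $X\in\mathfrak{gl}(T)$. *)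

theory Defs
  imports "HOL-Analysis.Analysis"
begin

text \<open>
  \<open>T\<close> is \<open>real^'n\<close>. Since \<open>T\<close> is finite-dimensional, every linear map out of \<open>T\<close>, \<open>T*\<close> or
  \<open>End T\<close> is bounded, so the type of bounded linear maps is the full space of linear maps; it
  also supplies the normed topology needed to differentiate.
\<close>

type_synonym 'n tvec = "real^'n"
type_synonym 'n tcovec = "'n tvec \<Rightarrow>\<^sub>L real"
type_synonym 'n endo = "'n tvec \<Rightarrow>\<^sub>L 'n tvec"

definition endo_trace :: "'n::finite endo \<Rightarrow> real" where
  "endo_trace A = trace (matrix (blinfun_apply A))"

definition std_basis :: "'n::finite \<Rightarrow> 'n tvec" where
  "std_basis i = axis i 1"

lift_definition dual_basis :: "'n::finite \<Rightarrow> 'n tcovec" is "\<lambda>i v. v $ i"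
  by (rule bounded_linear_vec_nth)

lift_definition endo_transpose :: "'n::finite endo \<Rightarrow> 'n tcovec \<Rightarrow>\<^sub>L 'n tcovec"
  is "\<lambda>A \<alpha>. \<alpha> o\<^sub>L A"
  by (rule bounded_bilinear.bounded_linear_left[OF bounded_bilinear_blinfun_compose])

definition V_lower :: "('n::finite tvec \<Rightarrow>\<^sub>L 'n endo) set" where
  "V_lower = {a :: 'n tvec \<Rightarrow>\<^sub>L 'n endo. (\<forall>v w. blinfun_apply (a v) w = - blinfun_apply (a w) v) \<and> (\<forall>v. endo_trace (a v) = 0)}"

definition V_upper :: "('n::finite tcovec \<Rightarrow>\<^sub>L 'n endo) set" where
  "V_upper = {b :: 'n tcovec \<Rightarrow>\<^sub>L 'n endo. (\<forall>\<alpha> \<beta>. endo_transpose (b \<alpha>) \<beta> = - endo_transpose (b \<beta>) \<alpha>) \<and>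
                 (\<forall>\<alpha>. endo_trace (b \<alpha>) = 0)}"

type_synonym 'n pair = "('n tvec \<Rightarrow>\<^sub>L 'n endo) \<times> ('n tcovec \<Rightarrow>\<^sub>L 'n endo)"

definition phase_space :: "'n::finite pair set" where
  "phase_space = V_lower \<times> V_upper"

definition duality :: "('n::finite tvec \<Rightarrow>\<^sub>L 'n endo) \<Rightarrow> ('n tcovec \<Rightarrow>\<^sub>L 'n endo) \<Rightarrow> real" where
  "duality a b = (\<Sum>i\<in>UNIV. endo_trace (a (std_basis i) o\<^sub>L b (dual_basis i)))"

definition gl_pairing :: "'n::finite endo \<Rightarrow> 'n endo \<Rightarrow> real" where
  "gl_pairing A X = endo_trace (A o\<^sub>L X)"

definition contr1 :: "('n::finite tvec \<Rightarrow>\<^sub>L 'n endo) \<Rightarrow> ('n tcovec \<Rightarrow>\<^sub>L 'n endo) \<Rightarrow> 'n endo" where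
  "contr1 a b = (\<Sum>i\<in>UNIV. a (std_basis i) o\<^sub>L b (dual_basis i))"

definition contr2 :: "('n::finite tvec \<Rightarrow>\<^sub>L 'n endo) \<Rightarrow> ('n tcovec \<Rightarrow>\<^sub>L 'n endo) \<Rightarrow> 'n endo" where
  "contr2 a b = (\<Sum>i\<in>UNIV. b (dual_basis i) o\<^sub>L a (std_basis i))"

definition GL :: "'n::finite endo set" where
  "GL = {g. bij (blinfun_apply g)}"

text \<open>Meaningful on \<open>GL\<close> only.\<close>
definition endo_inv :: "'n::finite endo \<Rightarrow> 'n endo" where
  "endo_inv g = Blinfun (inv (blinfun_apply g))"

lift_definition conj_action :: "'n::finite endo \<Rightarrow> 'n endo \<Rightarrow>\<^sub>L 'n endo"
  is "\<lambda>g A. g o\<^sub>L A o\<^sub>L endo_inv g"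
  by (intro bounded_linear_intros)

definition dual_action :: "'n::finite endo \<Rightarrow> 'n tcovec \<Rightarrow>\<^sub>L 'n tcovec" where
  "dual_action g = endo_transpose (endo_inv g)"

text \<open>The natural action on \<open>Hom(U, End T)\<close> is \<open>(g f)(u) = g (f (g\<^sup>-\<^sup>1 u))\<close>, for \<open>U = T\<close> and \<open>U = T*\<close>.\<close>
definition act_lower ::
    "'n::finite endo \<Rightarrow> ('n tvec \<Rightarrow>\<^sub>L 'n endo) \<Rightarrow> ('n tvec \<Rightarrow>\<^sub>L 'n endo)" where
  "act_lower g a = conj_action g o\<^sub>L a o\<^sub>L endo_inv g"

definition act_upper ::
    "'n::finite endo \<Rightarrow> ('n tcovec \<Rightarrow>\<^sub>L 'n endo) \<Rightarrow> ('n tcovec \<Rightarrow>\<^sub>L 'n endo)" where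
  "act_upper g b = conj_action g o\<^sub>L b o\<^sub>L dual_action (endo_inv g)"

definition act_pair :: "'n::finite endo \<Rightarrow> 'n pair \<Rightarrow> 'n pair" where
  "act_pair g p = (act_lower g (fst p), act_upper g (snd p))"

text \<open>\<open>X x\<close> is the differential at the identity of the orbit map \<open>g \<mapsto> g x\<close>, applied to \<open>X\<close>; as
  \<open>GL\<close> is open in \<open>End T\<close>, this does not depend on the values of \<open>act g x\<close> for \<open>g\<close> outside \<open>GL\<close>.\<close>
definition infinitesimal ::
    "('n::finite endo \<Rightarrow> 'v::real_normed_vector \<Rightarrow> 'v) \<Rightarrow> 'n endo \<Rightarrow> 'v \<Rightarrow> 'v" where
  "infinitesimal act X x = frechet_derivative (\<lambda>g. act g x) (at id_blinfun) X"

definition omega :: "'n::finite pair \<Rightarrow> 'n pair \<Rightarrow> 'n pair \<Rightarrow> real" where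
  "omega p q r = duality (fst q) (snd r) - duality (fst r) (snd q)"

text \<open>A two-form on a linear subspace \<open>M\<close>, with tangent spaces identified with \<open>M\<close>. Only forms with
  constant coefficients are covered, and these are automatically closed.\<close>
definition constant_symplectic_form_on ::
    "'v::real_vector set \<Rightarrow> ('v \<Rightarrow> 'v \<Rightarrow> 'v \<Rightarrow> real) \<Rightarrow> bool" where
  "constant_symplectic_form_on M w \<longleftrightarrow>
     subspace M \<and>
     (\<forall>p\<in>M. \<forall>p'\<in>M. \<forall>x\<in>M. \<forall>y\<in>M. w p x y = w p' x y) \<and>
     (\<forall>p\<in>M. \<forall>x\<in>M. \<forall>y\<in>M. \<forall>z\<in>M. \<forall>c. w p (c *\<^sub>R x + y) z = c * w p x z + w p y z) \<and>
     (\<forall>p\<in>M. \<forall>x\<in>M. \<forall>y\<in>M. w p x y = - w p y x) \<and>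
     (\<forall>p\<in>M. \<forall>x\<in>M. (\<forall>y\<in>M. w p x y = 0) \<longrightarrow> x = 0)"

text \<open>Moment map on a linear subspace \<open>M\<close>, with values in \<open>gl(T)\<close>, which is identified with its dual
  by the trace pairing; under it the coadjoint action is conjugation. The derivative is taken
  within \<open>M\<close>, so it is determined exactly on the tangent space \<open>M\<close>.\<close>
definition is_moment_map ::
    "'v::real_normed_vector set \<Rightarrow> ('n::finite endo \<Rightarrow> 'v \<Rightarrow> 'v) \<Rightarrow>
     ('v \<Rightarrow> 'v \<Rightarrow> 'v \<Rightarrow> real) \<Rightarrow> ('v \<Rightarrow> 'n endo) \<Rightarrow> bool" where
  "is_moment_map M act w m \<longleftrightarrow>
     (\<forall>g\<in>GL. \<forall>p\<in>M. m (act g p) = conj_action g (m p)) \<and>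
     (\<forall>p\<in>M. \<exists>D. (m has_derivative D) (at p within M) \<and>
        (\<forall>q\<in>M. \<forall>X. gl_pairing (D q) X = w p (infinitesimal act X p) q))"

definition mu :: "'n::finite pair \<Rightarrow> 'n endo" where
  "mu p = contr1 (fst p) (snd p) - 2 *\<^sub>R contr2 (fst p) (snd p)"

text \<open>The action restricts to the two subspaces.\<close>

lemma linear_endo: "linear (blinfun_apply A)"
  by (rule bounded_linear.linear[OF blinfun.bounded_linear_right])

lemma endo_inv_apply:
  assumes "g \<in> GL"
  shows "blinfun_apply (endo_inv g) = inv (blinfun_apply g)"
proof -
  have "inj (blinfun_apply g)" using assms by (simp add: GL_def bij_is_inj)
  then have "linear (inv (blinfun_apply g))"
    by (rule inj_linear_imp_inv_linear[OF linear_endo])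
  then show ?thesis unfolding endo_inv_def
    by (intro bounded_linear_Blinfun_apply) (rule linear_conv_bounded_linear[THEN iffD1])
qed

lemma endo_inv_cancel:
  assumes "g \<in> GL"
  shows "endo_inv g (g x) = x" "g (endo_inv g x) = x"
    "endo_inv g o\<^sub>L g = id_blinfun" "g o\<^sub>L endo_inv g = id_blinfun"
proof -
  have b: "bij (blinfun_apply g)" using assms by (simp add: GL_def)
  show 1: "endo_inv g (g x) = x" for x
    using b by (simp add: endo_inv_apply[OF assms] bij_is_inj)
  show 2: "g (endo_inv g x) = x" for x
    using b by (simp add: endo_inv_apply[OF assms] bij_is_surj surj_f_inv_f)
  show "endo_inv g o\<^sub>L g = id_blinfun" "g o\<^sub>L endo_inv g = id_blinfun"
    by (auto intro!: blinfun_eqI simp: 1 2)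
qed

lemma endo_inv_in_GL: "g \<in> GL \<Longrightarrow> endo_inv g \<in> GL"
  by (simp add: GL_def endo_inv_apply bij_imp_bij_inv)

lemma endo_inv_inv:
  assumes "g \<in> GL"
  shows "endo_inv (endo_inv g) = g"
proof (rule blinfun_eqI)
  fix x
  have "endo_inv (endo_inv g) (endo_inv g (g x)) = g x"
    by (rule endo_inv_cancel(1)[OF endo_inv_in_GL[OF assms]])
  then show "endo_inv (endo_inv g) x = g x"
    by (simp add: endo_inv_cancel(1)[OF assms])
qed

lemma endo_trace_commute:
  fixes A B :: "'n::finite endo"
  shows "endo_trace (A o\<^sub>L B) = endo_trace (B o\<^sub>L A)"
proof -
  have m: "matrix (blinfun_apply (C o\<^sub>L D)) = matrix (blinfun_apply C) ** matrix (blinfun_apply D)"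
    for C D :: "'n endo"
    unfolding blinfun_compose.rep_eq by (rule matrix_compose[OF linear_endo linear_endo])
  show ?thesis unfolding endo_trace_def m by (rule trace_mul_sym)
qed

lemma endo_trace_conj:
  assumes "g \<in> GL"
  shows "endo_trace (conj_action g A) = endo_trace A"
proof -
  have "endo_inv g o\<^sub>L (g o\<^sub>L A) = A"
    by (intro blinfun_eqI) (simp add: endo_inv_cancel[OF assms])
  then show ?thesis
    using endo_trace_commute[of "g o\<^sub>L A" "endo_inv g"] by (simp only: conj_action.rep_eq)
qed

lemma act_lower_mem:
  assumes "g \<in> GL" "a \<in> V_lower"
  shows "act_lower g a \<in> V_lower"
proof -
  note a = assms(2)[unfolded V_lower_def mem_Collect_eq]
  note anti = a[THEN conjunct1, rule_format] and tr = a[THEN conjunct2, rule_format]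
  have "blinfun_apply (act_lower g a v) w = - blinfun_apply (act_lower g a w) v" for v w
  proof -
    have "g (a (endo_inv g v) (endo_inv g w)) = - g (a (endo_inv g w) (endo_inv g v))"
      by (subst anti) (rule blinfun.minus_right)
    then show ?thesis by (simp only: act_lower_def conj_action.rep_eq blinfun_apply_blinfun_compose)
  qed
  moreover have "endo_trace (act_lower g a v) = 0" for v
    by (simp add: act_lower_def endo_trace_conj assms(1) tr)
  ultimately show ?thesis
    unfolding V_lower_def mem_Collect_eq by (intro conjI allI)
qed

lemma act_upper_mem:
  fixes b :: "'n::finite tcovec \<Rightarrow>\<^sub>L 'n endo"
  assumes "g \<in> GL" "b \<in> V_upper"
  shows "act_upper g b \<in> V_upper"
proof -
  note b = assms(2)[unfolded V_upper_def mem_Collect_eq]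
  note anti = b[THEN conjunct1, rule_format] and tr = b[THEN conjunct2, rule_format]
  have pt: "\<beta> (b \<alpha> x) = - \<alpha> (b \<beta> x)" for \<alpha> \<beta> :: "'n tcovec" and x
  proof -
    have "blinfun_apply (endo_transpose (b \<alpha>) \<beta>) x = blinfun_apply (- endo_transpose (b \<beta>) \<alpha>) x"
      by (subst anti) (rule refl)
    then show ?thesis
      by (simp only: endo_transpose.rep_eq blinfun_apply_blinfun_compose blinfun.minus_left)
  qed
  have "endo_transpose (act_upper g b \<alpha>) \<beta> = - endo_transpose (act_upper g b \<beta>) \<alpha>" for \<alpha> \<beta>
  proof (rule blinfun_eqI)
    fix x
    show "endo_transpose (act_upper g b \<alpha>) \<beta> x = (- endo_transpose (act_upper g b \<beta>) \<alpha>) x"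
      using pt[of "\<beta> o\<^sub>L g" "\<alpha> o\<^sub>L g" "endo_inv g x"]
      by (simp only: endo_transpose.rep_eq act_upper_def conj_action.rep_eq dual_action_def
          endo_inv_inv[OF assms(1)] blinfun.minus_left blinfun_apply_blinfun_compose)
  qed
  moreover have "endo_trace (act_upper g b \<alpha>) = 0" for \<alpha>
    by (simp add: act_upper_def endo_trace_conj assms(1) tr)
  ultimately show ?thesis
    unfolding V_upper_def mem_Collect_eq by (intro conjI allI)
qed

lemma act_pair_mem: "g \<in> GL \<Longrightarrow> p \<in> phase_space \<Longrightarrow> act_pair g p \<in> phase_space"
  by (auto simp: phase_space_def act_pair_def act_lower_mem act_upper_mem)

end

theory Submission
  imports Defs
begin

text \<open>
  The infinitesimal action is \<open>(Xa)(v) = [X, a(v)] - a(Xv)\<close>. Pairing with \<open>b\<close>, the commutator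
  contributes \<open>\<langle>c\<^sub>1 - c\<^sub>2, X\<rangle>\<close>, and skew-symmetry of \<open>a\<close> and \<open>b\<close> turns
  \<open>\<Sum>i. tr (a(X e\<^sub>i) b\<^sub>i)\<close> into a second \<open>\<langle>c\<^sub>2, X\<rangle>\<close>, whence \<open>\<langle>\<mu>(a,b), X\<rangle> = \<langle>Xa, b\<rangle>\<close>. As \<open>\<mu>\<close> is bilinear
  and the duality is invariant, \<open>\<langle>d\<mu>(v,w), X\<rangle> = \<langle>Xv, b\<rangle> + \<langle>Xa, w\<rangle> = \<langle>Xa, w\<rangle> - \<langle>v, Xb\<rangle>\<close>.
\<close>

section \<open>Inversion near the identity\<close>

lemma endo_inv_near_id:
  fixes g :: "'n::finite endo"
  assumes "norm (g - id_blinfun) < 1/2"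
  shows "g \<in> GL" and "norm (endo_inv g) \<le> 2"
proof -
  \<comment> \<open>Being within 1/2 of the identity, \<open>g\<close> moves \<open>x\<close> by at
    most half its norm. This lower bound on \<open>g x\<close> gives injectivity, hence bijectivity
    in finite dimension, and, at \<open>endo_inv g x\<close>, the bound on the inverse.\<close>
  have low: "norm x \<le> 2 * norm (g x)" for x
  proof -
    have "norm ((g - id_blinfun) x) \<le> norm (g - id_blinfun) * norm x" by (rule norm_blinfun)
    also have "\<dots> \<le> 1/2 * norm x" using assms by (intro mult_right_mono) auto
    finally have "norm (g x - x) \<le> 1/2 * norm x" by (simp add: blinfun.diff_left)
    moreover have "norm x \<le> norm (g x) + norm (g x - x)"
      using norm_triangle_sub[of x "g x"] by (simp add: norm_minus_commute)
    ultimately show ?thesis by linarith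
  qed
  have "inj (blinfun_apply g)"
    unfolding linear_injective_0[OF linear_endo]
  proof (intro allI impI)
    fix x assume "g x = 0"
    then show "x = 0" using low[of x] by simp
  qed
  then show gl: "g \<in> GL"
    by (simp add: GL_def bij_def linear_injective_imp_surjective[OF linear_endo])
  show "norm (endo_inv g) \<le> 2"
  proof (rule norm_blinfun_bound)
    fix x show "norm (endo_inv g x) \<le> 2 * norm x"
      using low[of "endo_inv g x"] by (simp add: endo_inv_cancel(2)[OF gl])
  qed simp
qed

lemma blinfun_compose_id: "id_blinfun o\<^sub>L f = f" "f o\<^sub>L id_blinfun = f"
  by (auto intro!: blinfun_eqI)

lemma endo_inv_id: "endo_inv id_blinfun = (id_blinfun :: 'n::finite endo)"
proof -
  have "(id_blinfun :: 'n endo) \<in> GL" by (simp add: GL_def bij_def)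
  from endo_inv_cancel(3)[OF this] show ?thesis by (simp only: blinfun_compose_id)
qed

lemma eventually_GL: "eventually (\<lambda>g. g \<in> GL) (at (id_blinfun :: 'n::finite endo))"
  unfolding eventually_at by (intro exI[of _ "1/2"]) (auto simp: dist_norm intro: endo_inv_near_id)

text \<open>With \<open>H = g - id_blinfun\<close>, the remainder
  \<open>endo_inv g - id_blinfun + H\<close> equals \<open>endo_inv g o H o H\<close>. Within
  distance 1/2 of the identity the inverse has norm at most 2, so the remainder is at most twice the
  square of \<open>norm H\<close>.\<close>

lemma has_derivative_endo_inv:
  "(endo_inv has_derivative uminus) (at (id_blinfun :: 'n::finite endo))"
proof (rule has_derivativeI_sandwich[of "1/2"])
  fix g :: "'n endo"
  assume ne: "g \<noteq> id_blinfun" and d: "dist g id_blinfun < 1/2"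
  define H where "H = g - id_blinfun"
  have g: "g \<in> GL" and n: "norm (endo_inv g) \<le> 2"
    using endo_inv_near_id[of g] d by (auto simp: dist_norm)
  have "endo_inv g - id_blinfun + H = endo_inv g o\<^sub>L H o\<^sub>L H"
    by (intro blinfun_eqI)
      (simp add: H_def blinfun.diff_left blinfun.add_left blinfun.diff_right endo_inv_cancel[OF g])
  then have "norm (endo_inv g - id_blinfun + H) \<le> norm (endo_inv g o\<^sub>L H) * norm H"
    by (simp add: norm_blinfun_compose)
  also have "\<dots> \<le> (norm (endo_inv g) * norm H) * norm H"
    by (intro mult_right_mono norm_blinfun_compose) auto
  also have "\<dots> \<le> (2 * norm H) * norm H" using n by (intro mult_right_mono) auto
  finally have "norm (endo_inv g - id_blinfun + H) \<le> 2 * norm H * norm H" .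
  moreover have "norm H > 0" using ne by (simp add: H_def)
  ultimately have "norm (endo_inv g - id_blinfun + H) / norm H \<le> 2 * norm H"
    by (simp add: divide_le_eq)
  moreover have "(endo_inv g - endo_inv id_blinfun) - - (g - id_blinfun) = endo_inv g - id_blinfun + H"
    by (simp add: endo_inv_id H_def)
  ultimately show "norm ((endo_inv g - endo_inv id_blinfun) - - (g - id_blinfun)) / norm (g - id_blinfun)
      \<le> 2 * norm (g - id_blinfun)"
    by (simp only: H_def)
next
  show "((\<lambda>g. 2 * norm (g - id_blinfun)) \<longlongrightarrow> 0) (at (id_blinfun :: 'n endo))"
    by (intro tendsto_mult_right_zero tendsto_norm_zero LIM_zero tendsto_ident_at)
qed (auto intro: bounded_linear_minus bounded_linear_ident)

section \<open>The infinitesimal actions\<close>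

definition lmul :: "'n::finite endo \<Rightarrow> 'n endo \<Rightarrow>\<^sub>L 'n endo" where
  "lmul = bounded_bilinear.prod_right (o\<^sub>L)"

definition rmul :: "'n::finite endo \<Rightarrow> 'n endo \<Rightarrow>\<^sub>L 'n endo" where
  "rmul = bounded_bilinear.prod_left (o\<^sub>L)"

lemma lmul_apply [simp]: "lmul A B = A o\<^sub>L B"
  by (simp add: lmul_def bounded_bilinear.prod_right.rep_eq[OF bounded_bilinear_blinfun_compose])

lemma rmul_apply [simp]: "rmul A B = B o\<^sub>L A"
  by (simp add: rmul_def bounded_bilinear.prod_left.rep_eq[OF bounded_bilinear_blinfun_compose])

lemma bounded_linear_lmul: "bounded_linear lmul"
  unfolding lmul_def
  by (rule bounded_bilinear.bounded_linear_prod_right[OF bounded_bilinear_blinfun_compose])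

lemma bounded_linear_rmul: "bounded_linear rmul"
  unfolding rmul_def
  by (rule bounded_bilinear.bounded_linear_prod_left[OF bounded_bilinear_blinfun_compose])

lemma bounded_linear_endo_transpose: "bounded_linear (endo_transpose :: 'n::finite endo \<Rightarrow> _)"
proof -
  have "endo_transpose = (bounded_bilinear.prod_left (o\<^sub>L) :: 'n endo \<Rightarrow> 'n tcovec \<Rightarrow>\<^sub>L 'n tcovec)"
    by (intro ext blinfun_eqI)
      (simp add: endo_transpose.rep_eq
        bounded_bilinear.prod_left.rep_eq[OF bounded_bilinear_blinfun_compose])
  then show ?thesis
    using bounded_bilinear.bounded_linear_prod_left[OF bounded_bilinear_blinfun_compose] by metis
qed

definition ad :: "'n::finite endo \<Rightarrow> 'n endo \<Rightarrow>\<^sub>L 'n endo" where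
  "ad X = lmul X - rmul X"

lemma ad_apply [simp]: "ad X A = (X o\<^sub>L A) - (A o\<^sub>L X)"
  by (simp add: ad_def blinfun.diff_left)

lemma lmul_rmul_id: "lmul id_blinfun = id_blinfun" "rmul id_blinfun = id_blinfun"
  by (auto intro!: blinfun_eqI)

lemma endo_transpose_id: "endo_transpose id_blinfun = id_blinfun"
  by (auto intro!: blinfun_eqI simp: endo_transpose.rep_eq)

text \<open>Gives conjugation a form to which the product rule applies: a composite of two operators
  on \<open>End T\<close>, one linear in \<open>g\<close> and the other linear in
  \<open>endo_inv g\<close>.\<close>

lemma conj_action_eq: "conj_action g = lmul g o\<^sub>L rmul (endo_inv g)"
  by (intro blinfun_eqI) (simp add: conj_action.rep_eq)

lemmas compose_FDERIV = bounded_bilinear.FDERIV[OF bounded_bilinear_blinfun_compose]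

text \<open>Since inversion has derivative \<open>- X\<close>, the product rule leaves left minus
  right multiplication by \<open>X\<close>, the commutator.\<close>

lemma has_derivative_conj_action:
  "(conj_action has_derivative ad) (at (id_blinfun :: 'n::finite endo))"
proof -
  have "((\<lambda>g :: 'n endo. lmul g o\<^sub>L rmul (endo_inv g)) has_derivative
     (\<lambda>X. (lmul id_blinfun o\<^sub>L rmul (- X)) + (lmul X o\<^sub>L rmul (endo_inv id_blinfun)))) (at id_blinfun)"
    by (intro compose_FDERIV bounded_linear.has_derivative[OF bounded_linear_lmul]
        bounded_linear.has_derivative[OF bounded_linear_rmul] has_derivative_endo_inv
        has_derivative_ident)
  moreover have "(\<lambda>X :: 'n endo. (lmul id_blinfun o\<^sub>L rmul (- X)) + (lmul X o\<^sub>L rmul (endo_inv id_blinfun))) = ad"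
    by (simp add: fun_eq_iff ad_def endo_inv_id lmul_rmul_id blinfun_compose_id
        linear_neg[OF bounded_linear.linear[OF bounded_linear_rmul]])
  ultimately show ?thesis by (simp add: conj_action_eq[abs_def])
qed

lemma conj_action_id: "conj_action id_blinfun = id_blinfun"
  by (simp add: conj_action_eq endo_inv_id lmul_rmul_id blinfun_compose_id)

definition lie_lower :: "'n::finite endo \<Rightarrow> ('n tvec \<Rightarrow>\<^sub>L 'n endo) \<Rightarrow> ('n tvec \<Rightarrow>\<^sub>L 'n endo)" where
  "lie_lower X a = (ad X o\<^sub>L a) - (a o\<^sub>L X)"

text \<open>The plus sign comes from the dual representation: \<open>X\<close> acts on covectors by
  minus its transpose, and the action on a space of linear maps subtracts the action on the
  source.\<close>

definition lie_upper :: "'n::finite endo \<Rightarrow> ('n tcovec \<Rightarrow>\<^sub>L 'n endo) \<Rightarrow> ('n tcovec \<Rightarrow>\<^sub>L 'n endo)" where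
  "lie_upper X b = (ad X o\<^sub>L b) + (b o\<^sub>L endo_transpose X)"

lemma has_derivative_act_lower:
  "((\<lambda>g. act_lower g a) has_derivative (\<lambda>X. lie_lower X a)) (at (id_blinfun :: 'n::finite endo))"
proof -
  \<comment> \<open>The product rule for three factors; the \<open>0\<close> is the derivative of
    the constant middle factor \<open>a\<close>.\<close>
  have "((\<lambda>g :: 'n endo. conj_action g o\<^sub>L a o\<^sub>L endo_inv g) has_derivative
     (\<lambda>X. (conj_action id_blinfun o\<^sub>L a o\<^sub>L - X) +
       (((conj_action id_blinfun o\<^sub>L 0) + (ad X o\<^sub>L a)) o\<^sub>L endo_inv id_blinfun))) (at id_blinfun)"
    by (intro compose_FDERIV has_derivative_endo_inv has_derivative_conj_action has_derivative_const)
  moreover have "(\<lambda>X. (conj_action id_blinfun o\<^sub>L a o\<^sub>L - X) +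
       (((conj_action id_blinfun o\<^sub>L 0) + (ad X o\<^sub>L a)) o\<^sub>L endo_inv id_blinfun)) = (\<lambda>X. lie_lower X a)"
    by (auto simp: fun_eq_iff lie_lower_def conj_action_id endo_inv_id blinfun_compose_id
        blinfun.bilinear_simps intro!: blinfun_eqI)
  ultimately show ?thesis by (simp add: act_lower_def)
qed

text \<open>The action on covectors involves the double inverse of \<open>g\<close>, which is known
  to equal \<open>g\<close> on \<open>GL\<close>. So the derivative is computed with
  \<open>endo_transpose g\<close>, which is linear in \<open>g\<close>, and transferred, as the two
  expressions agree at and near the identity.\<close>

lemma has_derivative_act_upper:
  "((\<lambda>g. act_upper g b) has_derivative (\<lambda>X. lie_upper X b)) (at (id_blinfun :: 'n::finite endo))"
proof -
  have "((\<lambda>g :: 'n endo. conj_action g o\<^sub>L b o\<^sub>L endo_transpose g) has_derivative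
     (\<lambda>X. (conj_action id_blinfun o\<^sub>L b o\<^sub>L endo_transpose X) +
       (((conj_action id_blinfun o\<^sub>L 0) + (ad X o\<^sub>L b)) o\<^sub>L endo_transpose id_blinfun))) (at id_blinfun)"
    by (intro compose_FDERIV bounded_linear.has_derivative[OF bounded_linear_endo_transpose]
        has_derivative_conj_action has_derivative_const has_derivative_ident)
  moreover have "(\<lambda>X. (conj_action id_blinfun o\<^sub>L b o\<^sub>L endo_transpose X) +
       (((conj_action id_blinfun o\<^sub>L 0) + (ad X o\<^sub>L b)) o\<^sub>L endo_transpose id_blinfun)) =
       (\<lambda>X. lie_upper X b)"
    by (auto simp: fun_eq_iff lie_upper_def conj_action_id endo_transpose_id blinfun_compose_id
        blinfun.bilinear_simps intro!: blinfun_eqI)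
  ultimately have "((\<lambda>g. conj_action g o\<^sub>L b o\<^sub>L endo_transpose g) has_derivative (\<lambda>X. lie_upper X b))
      (at (id_blinfun :: 'n endo))" by simp
  then show ?thesis
  proof (rule has_derivative_transform_eventually)
    show "\<forall>\<^sub>F g in at id_blinfun. conj_action g o\<^sub>L b o\<^sub>L endo_transpose g = act_upper g b"
      using eventually_GL
      by eventually_elim (simp add: act_upper_def dual_action_def endo_inv_inv)
  qed (auto simp: act_upper_def dual_action_def endo_inv_id)
qed

text \<open>Uniqueness of the Frechet derivative: any derivative that has been exhibited is the one
  selected by \<open>frechet_derivative\<close>.\<close>

lemma infinitesimal_eq:
  assumes "((\<lambda>g. act g x) has_derivative D) (at id_blinfun)"
  shows "infinitesimal act X x = D X"
  unfolding infinitesimal_def using frechet_derivative_at[OF assms] by simp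

lemma infinitesimal_act_lower: "infinitesimal act_lower X a = lie_lower X a"
  by (rule infinitesimal_eq[OF has_derivative_act_lower])

lemma infinitesimal_act_pair:
  "infinitesimal act_pair X p = (lie_lower X (fst p), lie_upper X (snd p))"
  by (rule infinitesimal_eq)
    (simp only: act_pair_def has_derivative_Pair has_derivative_act_lower has_derivative_act_upper)

section \<open>Basis expansions, traces and invariance of the duality\<close>

lemma std_basis_expansion: "(\<Sum>j\<in>UNIV. (v $ j) *\<^sub>R std_basis j) = v"
  unfolding std_basis_def by (simp add: vec_eq_iff axis_def if_distrib cong: if_cong)

lemma dual_basis_apply [simp]: "dual_basis i v = v $ i"
  by (simp add: dual_basis.rep_eq)

lemma dual_basis_expansion:
  fixes \<alpha> :: "'n::finite tcovec"
  shows "(\<Sum>j\<in>UNIV. \<alpha> (std_basis j) *\<^sub>R dual_basis j) = \<alpha>"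
proof (rule blinfun_eqI)
  fix v
  have "\<alpha> v = \<alpha> (\<Sum>j\<in>UNIV. (v $ j) *\<^sub>R std_basis j)" by (simp add: std_basis_expansion)
  then show "(\<Sum>j\<in>UNIV. \<alpha> (std_basis j) *\<^sub>R dual_basis j) v = \<alpha> v"
    by (simp add: blinfun.sum_left blinfun.sum_right blinfun.scaleR_left blinfun.scaleR_right mult.commute)
qed

text \<open>This expresses that the canonical element of \<open>T \<otimes> T*\<close> is annihilated by \<open>gl(T)\<close>; invariance
  of the duality and equivariance of the contractions both come from it.\<close>
lemma sum_basis_transfer:
  fixes X :: "'n::finite endo" and F :: "'n tvec \<Rightarrow> 'n tcovec \<Rightarrow> 'v::real_vector"
  assumes "\<And>\<alpha>. linear (\<lambda>v. F v \<alpha>)" "\<And>v. linear (F v)"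
  shows "(\<Sum>i\<in>UNIV. F (X (std_basis i)) (dual_basis i)) = (\<Sum>i\<in>UNIV. F (std_basis i) (dual_basis i o\<^sub>L X))"
proof -
  have "(\<Sum>i\<in>UNIV. F (X (std_basis i)) (dual_basis i)) =
      (\<Sum>i\<in>UNIV. F (\<Sum>j\<in>UNIV. (X (std_basis i) $ j) *\<^sub>R std_basis j) (dual_basis i))"
    by (simp add: std_basis_expansion)
  also have "\<dots> = (\<Sum>i\<in>UNIV. \<Sum>j\<in>UNIV. (X (std_basis i) $ j) *\<^sub>R F (std_basis j) (dual_basis i))"
    by (simp add: linear_sum[OF assms(1)] linear_cmul[OF assms(1)])
  also have "\<dots> = (\<Sum>j\<in>UNIV. \<Sum>i\<in>UNIV. (X (std_basis i) $ j) *\<^sub>R F (std_basis j) (dual_basis i))"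
    by (rule sum.swap)
  also have "\<dots> = (\<Sum>j\<in>UNIV. F (std_basis j)
      (\<Sum>i\<in>UNIV. (dual_basis j o\<^sub>L X) (std_basis i) *\<^sub>R dual_basis i))"
    by (simp add: linear_sum[OF assms(2)] linear_cmul[OF assms(2)])
  finally show ?thesis by (simp only: dual_basis_expansion)
qed

lemma blinfun_compose_bilinear:
  "linear (\<lambda>A. A o\<^sub>L B)" "linear (\<lambda>B. A o\<^sub>L B)"
  by (auto intro!: bounded_linear.linear
      bounded_bilinear.bounded_linear_left[OF bounded_bilinear_blinfun_compose]
      bounded_bilinear.bounded_linear_right[OF bounded_bilinear_blinfun_compose])

lemma endo_trace_eq: "endo_trace A = (\<Sum>k\<in>UNIV. A (std_basis k) $ k)"
  by (simp add: endo_trace_def trace_def matrix_def std_basis_def)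

lemma linear_endo_trace: "linear endo_trace"
  by (auto intro!: linearI simp: endo_trace_eq blinfun.bilinear_simps sum.distrib sum_distrib_left)

lemmas endo_trace_simps = linear_add[OF linear_endo_trace] linear_diff[OF linear_endo_trace]
  linear_cmul[OF linear_endo_trace] linear_sum[OF linear_endo_trace] linear_neg[OF linear_endo_trace]
  linear_0[OF linear_endo_trace]

lemmas compose_simps =
  linear_add[OF blinfun_compose_bilinear(1)] linear_add[OF blinfun_compose_bilinear(2)]
  linear_diff[OF blinfun_compose_bilinear(1)] linear_diff[OF blinfun_compose_bilinear(2)]
  linear_cmul[OF blinfun_compose_bilinear(1)] linear_cmul[OF blinfun_compose_bilinear(2)]
  linear_sum[OF blinfun_compose_bilinear(1)] linear_sum[OF blinfun_compose_bilinear(2)]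

lemma linear_blinfun_apply: "linear (blinfun_apply f)"
  by (rule bounded_linear.linear[OF blinfun.bounded_linear_right])

text \<open>Supplies the linearity in each slot that the basis lemmas require. \<open>H\<close> is
  the trace when the duality is treated and a conjugation when the contractions are.\<close>

lemma linear_through_compose:
  fixes a :: "'n::finite tvec \<Rightarrow>\<^sub>L 'n endo" and b :: "'n tcovec \<Rightarrow>\<^sub>L 'n endo"
  assumes "linear (H :: 'n endo \<Rightarrow> 'v::real_vector)"
  shows "linear (\<lambda>v. H (a v o\<^sub>L B))" "linear (\<lambda>\<alpha>. H (A o\<^sub>L b \<alpha>))"
    "linear (\<lambda>v. H (B o\<^sub>L a v))" "linear (\<lambda>\<alpha>. H (b \<alpha> o\<^sub>L A))"
  by (auto intro!: linearI simp: blinfun.bilinear_simps compose_simps linear_add[OF assms] linear_cmul[OF assms])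

lemma blinfun_compose_assoc: "(f o\<^sub>L g) o\<^sub>L h = f o\<^sub>L (g o\<^sub>L h)"
  by (auto intro!: blinfun_eqI)

text \<open>Cyclicity of the trace moves the commutator with \<open>X\<close> from a_i to b_i with a
  sign; \<open>sum_basis_transfer\<close> matches the remaining terms, in which \<open>X\<close>
  acts on e_i or, transposed, on e^i.\<close>

lemma duality_lie_invariant: "duality (lie_lower X a) b = - duality a (lie_upper X b)"
proof -
  have *: "(\<Sum>i\<in>UNIV. endo_trace (a (X (std_basis i)) o\<^sub>L b (dual_basis i))) =
      (\<Sum>i\<in>UNIV. endo_trace (a (std_basis i) o\<^sub>L b (dual_basis i o\<^sub>L X)))"
    by (rule sum_basis_transfer) (intro linear_through_compose linear_endo_trace)+
  have cyc: "endo_trace (a (std_basis i) o\<^sub>L (b (dual_basis i) o\<^sub>L X)) =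
      endo_trace (X o\<^sub>L (a (std_basis i) o\<^sub>L b (dual_basis i)))" for i
    using endo_trace_commute[of "a (std_basis i) o\<^sub>L b (dual_basis i)" X]
    by (simp add: blinfun_compose_assoc)
  show ?thesis
    by (simp add: duality_def lie_lower_def lie_upper_def blinfun.bilinear_simps compose_simps
        endo_trace_simps sum.distrib sum_subtractf * endo_transpose.rep_eq blinfun_compose_assoc cyc)
qed

section \<open>The pairing of \<open>mu\<close> with an endomorphism\<close>

lemma V_lowerI:
  fixes a :: "'n::finite tvec \<Rightarrow>\<^sub>L 'n endo"
  shows
  "(\<And>v w. a v w = - a w v) \<Longrightarrow> (\<And>v. endo_trace (a v) = 0) \<Longrightarrow> a \<in> V_lower"
  unfolding V_lower_def by blast

lemma V_lower_skew: "a \<in> V_lower \<Longrightarrow> a v w = - a w v"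
  unfolding V_lower_def by blast

lemma V_lower_trace: "a \<in> V_lower \<Longrightarrow> endo_trace (a v) = 0"
  unfolding V_lower_def by blast

text \<open>Reduces the skewness condition of \<open>V_upper\<close>, an equation of covectors, to
  scalar equations that can be used inside a trace.\<close>

lemma endo_transpose_skew_iff:
  fixes \<alpha> \<beta> :: "'n::finite tcovec"
  shows "endo_transpose A \<beta> = - endo_transpose B \<alpha> \<longleftrightarrow> (\<forall>x. \<beta> (A x) = - \<alpha> (B x))"
  by (simp add: blinfun_apply_inject[symmetric] fun_eq_iff endo_transpose.rep_eq blinfun.minus_left)

lemma V_upperI:
  fixes b :: "'n::finite tcovec \<Rightarrow>\<^sub>L 'n endo"
  assumes "\<And>\<alpha> \<beta> x. blinfun_apply \<beta> (b \<alpha> x) = - blinfun_apply \<alpha> (b \<beta> x)"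
    and "\<And>\<alpha>. endo_trace (b \<alpha>) = 0"
  shows "b \<in> V_upper"
  unfolding V_upper_def endo_transpose_skew_iff using assms by blast

lemma V_upper_skew:
  fixes \<alpha> \<beta> :: "'n::finite tcovec"
  shows "b \<in> V_upper \<Longrightarrow> \<beta> (b \<alpha> x) = - \<alpha> (b \<beta> x)"
  unfolding V_upper_def endo_transpose_skew_iff by blast

lemma V_upper_trace: "b \<in> V_upper \<Longrightarrow> endo_trace (b \<alpha>) = 0"
  unfolding V_upper_def by blast

lemma endo_trace_compose:
  fixes A B :: "'n::finite endo"
  shows
  "endo_trace (A o\<^sub>L B) = (\<Sum>k\<in>UNIV. \<Sum>l\<in>UNIV. B (std_basis k) $ l * A (std_basis l) $ k)"
proof -
  have "(A (B (std_basis k))) $ k = (\<Sum>l\<in>UNIV. B (std_basis k) $ l * A (std_basis l) $ k)" for k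
  proof -
    have "A (B (std_basis k)) = A (\<Sum>l\<in>UNIV. (B (std_basis k) $ l) *\<^sub>R std_basis l)"
      by (simp add: std_basis_expansion)
    then show ?thesis by (simp add: blinfun.sum_right blinfun.scaleR_right)
  qed
  then show ?thesis by (simp add: endo_trace_eq)
qed

text \<open>This is the source of the factor 2 in \<open>mu\<close>. Expand tr(b_i a(u)) as the sum
  over k of e^k(b_i(a(u) e_k)). Skewness of \<open>b\<close> exchanges e^k and e^i, skewness of
  \<open>a\<close> exchanges u and e_k, and the two signs cancel. The result is the i-th coordinate
  of \<open>contr2 a b u\<close>; summing over i with u = X e_i gives the trace.\<close>

lemma trace_contr2_compose:
  fixes X :: "'n::finite endo"
  assumes a: "a \<in> V_lower" and b: "b \<in> V_upper"
  shows "(\<Sum>i\<in>UNIV. endo_trace (a (X (std_basis i)) o\<^sub>L b (dual_basis i))) = endo_trace (contr2 a b o\<^sub>L X)"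
proof -
  have 1: "endo_trace (a u o\<^sub>L b (dual_basis i)) = (\<Sum>k\<in>UNIV. b (dual_basis k) (a (std_basis k) u) $ i)"
    for u :: "'n tvec" and i :: 'n
  proof -
    have "endo_trace (a u o\<^sub>L b (dual_basis i)) = endo_trace (b (dual_basis i) o\<^sub>L a u)"
      by (rule endo_trace_commute)
    also have "\<dots> = (\<Sum>k\<in>UNIV. dual_basis k (b (dual_basis i) (a u (std_basis k))))"
      by (simp add: endo_trace_eq)
    also have "\<dots> = (\<Sum>k\<in>UNIV. dual_basis i (b (dual_basis k) (a (std_basis k) u)))"
      by (subst V_upper_skew[OF b], subst V_lower_skew[OF a]) (simp add: blinfun.minus_right)
    finally show ?thesis by simp
  qed
  show ?thesis
    unfolding 1 by (simp add: endo_trace_eq contr2_def blinfun.sum_left)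
qed

lemma gl_pairing_mu:
  assumes "a \<in> V_lower" "b \<in> V_upper"
  shows "gl_pairing (mu (a, b)) X = duality (lie_lower X a) b"
proof -
  \<comment> \<open>Cyclicity brings \<open>X\<close> to the right in both halves of the commutator,
    which then give \<open>contr1\<close> and the first copy of \<open>contr2\<close>; the second
    copy is \<open>trace_contr2_compose\<close>.\<close>
  have "endo_trace (X o\<^sub>L (a (std_basis i) o\<^sub>L b (dual_basis i))) =
      endo_trace (a (std_basis i) o\<^sub>L (b (dual_basis i) o\<^sub>L X))" for i
    using endo_trace_commute[of "a (std_basis i) o\<^sub>L b (dual_basis i)" X]
    by (simp add: blinfun_compose_assoc)
  moreover have "endo_trace (a (std_basis i) o\<^sub>L (X o\<^sub>L b (dual_basis i))) =
      endo_trace (b (dual_basis i) o\<^sub>L (a (std_basis i) o\<^sub>L X))" for i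
    using endo_trace_commute[of "a (std_basis i) o\<^sub>L X" "b (dual_basis i)"]
    by (simp add: blinfun_compose_assoc)
  ultimately show ?thesis
    using trace_contr2_compose[OF assms, of X]
    by (simp add: duality_def gl_pairing_def mu_def contr1_def contr2_def lie_lower_def
        blinfun.bilinear_simps compose_simps endo_trace_simps sum.distrib sum_subtractf blinfun_compose_assoc)
qed

section \<open>Equivariance of \<open>mu\<close>\<close>

lemma sum_basis_change:
  fixes g h :: "'n::finite endo" and F :: "'n tvec \<Rightarrow> 'n tcovec \<Rightarrow> 'v::real_vector"
  assumes F: "\<And>\<alpha>. linear (\<lambda>v. F v \<alpha>)" "\<And>v. linear (F v)" and hg: "h o\<^sub>L g = id_blinfun"
  shows "(\<Sum>i\<in>UNIV. F (h (std_basis i)) (dual_basis i o\<^sub>L g)) = (\<Sum>i\<in>UNIV. F (std_basis i) (dual_basis i))"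
proof -
  \<comment> \<open>Transfer is applied to the bilinear map sending v and \<alpha> to
    \<open>F v\<close> at \<alpha> composed with \<open>g\<close>. This puts \<open>h\<close> on the
    covector, where it cancels against \<open>g\<close>.\<close>
  have "(\<Sum>i\<in>UNIV. F (h (std_basis i)) (dual_basis i o\<^sub>L g)) =
      (\<Sum>i\<in>UNIV. F (std_basis i) ((dual_basis i o\<^sub>L h) o\<^sub>L g))"
  proof (rule sum_basis_transfer)
    show "linear (\<lambda>\<alpha>. F v (\<alpha> o\<^sub>L g))" for v
      using linear_compose[OF blinfun_compose_bilinear(1) F(2)] by (simp add: o_def)
  qed (rule F)
  then show ?thesis by (simp add: blinfun_compose_assoc hg blinfun_compose_id)
qed

text \<open>Conjugation is multiplicative, so it factors out of every composite. What remains is the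
  contraction taken over the bases \<open>endo_inv g\<close> e_i and e^i o \<open>g\<close>, which
  are again dual to each other.\<close>

lemma contr_equivariant:
  fixes g :: "'n::finite endo"
  assumes g: "g \<in> GL"
  shows "contr1 (act_lower g a) (act_upper g b) = conj_action g (contr1 a b)"
    and "contr2 (act_lower g a) (act_upper g b) = conj_action g (contr2 a b)"
proof -
  have c: "conj_action g A o\<^sub>L conj_action g B = conj_action g (A o\<^sub>L B)" for A B
    by (intro blinfun_eqI) (simp add: conj_action.rep_eq endo_inv_cancel[OF g])
  have l: "linear (blinfun_apply (conj_action g))" by (rule linear_blinfun_apply)
  note [simp] = act_lower_def act_upper_def dual_action_def endo_inv_inv[OF g]
    endo_transpose.rep_eq c
  show "contr1 (act_lower g a) (act_upper g b) = conj_action g (contr1 a b)"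
    unfolding contr1_def linear_sum[OF l]
    using sum_basis_change[where F="\<lambda>v \<alpha>. conj_action g (a v o\<^sub>L b \<alpha>)",
        OF linear_through_compose(1)[OF l] linear_through_compose(2)[OF l] endo_inv_cancel(3)[OF g]] by simp
  show "contr2 (act_lower g a) (act_upper g b) = conj_action g (contr2 a b)"
    unfolding contr2_def linear_sum[OF l]
    using sum_basis_change[where F="\<lambda>v \<alpha>. conj_action g (b \<alpha> o\<^sub>L a v)",
        OF linear_through_compose(3)[OF l] linear_through_compose(4)[OF l] endo_inv_cancel(3)[OF g]] by simp
qed

lemma mu_equivariant: "g \<in> GL \<Longrightarrow> mu (act_pair g p) = conj_action g (mu p)"
  by (simp add: mu_def act_pair_def contr_equivariant blinfun.bilinear_simps)

section \<open>The derivative of \<open>mu\<close> and the moment map condition\<close>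

lemma has_derivative_mu:
  fixes p :: "'n::finite pair"
  shows "(mu has_derivative (\<lambda>q. mu (fst p, snd q) + mu (fst q, snd p))) (at p within M)"
proof -
  have d: "((\<lambda>q :: 'n pair. blinfun_apply (fst q) v) has_derivative (\<lambda>q. blinfun_apply (fst q) v)) (at p within M)"
    "((\<lambda>q :: 'n pair. blinfun_apply (snd q) \<alpha>) has_derivative (\<lambda>q. blinfun_apply (snd q) \<alpha>)) (at p within M)"
    for v \<alpha>
    by (auto intro!: bounded_linear_imp_has_derivative bounded_linear_compose[OF blinfun.bounded_linear_left]
        bounded_linear_fst bounded_linear_snd)
  have "((\<lambda>q. mu q) has_derivative
     (\<lambda>q. (\<Sum>i\<in>UNIV. (blinfun_apply (fst p) (std_basis i) o\<^sub>L blinfun_apply (snd q) (dual_basis i)) + (blinfun_apply (fst q) (std_basis i) o\<^sub>L blinfun_apply (snd p) (dual_basis i)))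
       - 2 *\<^sub>R (\<Sum>i\<in>UNIV. (blinfun_apply (snd p) (dual_basis i) o\<^sub>L blinfun_apply (fst q) (std_basis i)) + (blinfun_apply (snd q) (dual_basis i) o\<^sub>L blinfun_apply (fst p) (std_basis i)))))
     (at p within M)"
    unfolding mu_def contr1_def contr2_def
    by (intro has_derivative_diff has_derivative_sum has_derivative_scaleR_right compose_FDERIV d)
  then show ?thesis
    by (rule has_derivative_eq_rhs)
      (auto simp: fun_eq_iff mu_def contr1_def contr2_def sum.distrib algebra_simps)
qed

lemma duality_add:
  "duality (a + a') b = duality a b + duality a' b" "duality a (b + b') = duality a b + duality a b'"
  by (auto simp: duality_def blinfun.bilinear_simps compose_simps endo_trace_simps sum.distrib)

lemma duality_scaleR:
  "duality (c *\<^sub>R a) b = c * duality a b" "duality a (c *\<^sub>R b) = c * duality a b"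
  by (auto simp: duality_def blinfun.bilinear_simps compose_simps endo_trace_simps sum_distrib_left)

lemma duality_zero: "duality 0 b = 0" "duality a 0 = 0"
  using duality_scaleR(1)[of 0 0 b] duality_scaleR(2)[of a 0 0] by auto

lemma is_moment_map_mu: "is_moment_map phase_space act_pair omega (mu :: 'n::finite pair \<Rightarrow> 'n endo)"
  unfolding is_moment_map_def
proof (intro conjI ballI)
  fix p :: "'n pair" assume p: "p \<in> phase_space"
  have "gl_pairing (mu (fst p, snd q) + mu (fst q, snd p)) X = omega p (infinitesimal act_pair X p) q"
    if "q \<in> phase_space" for q and X :: "'n endo"
  proof -
    have "gl_pairing (mu (fst p, snd q) + mu (fst q, snd p)) X =
        gl_pairing (mu (fst p, snd q)) X + gl_pairing (mu (fst q, snd p)) X"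
      by (simp add: gl_pairing_def compose_simps endo_trace_simps)
    \<comment> \<open>As \<open>phase_space\<close> is a product, the mixed pairs lie in it too and
      \<open>gl_pairing_mu\<close> applies to both. Invariance then moves \<open>X\<close> from
      \<open>fst q\<close> to \<open>snd p\<close>, which produces the minus sign of
      \<open>omega\<close>.\<close>
    also have "\<dots> = duality (lie_lower X (fst p)) (snd q) - duality (fst q) (lie_upper X (snd p))"
      using p that by (simp add: phase_space_def mem_Times_iff gl_pairing_mu duality_lie_invariant[of X "fst q"])
    finally show ?thesis by (simp add: omega_def infinitesimal_act_pair)
  qed
  then show "\<exists>D. (mu has_derivative D) (at p within phase_space) \<and>
        (\<forall>q\<in>phase_space. \<forall>X. gl_pairing (D q) X = omega p (infinitesimal act_pair X p) q)"
    by (intro exI[of _ "\<lambda>q. mu (fst p, snd q) + mu (fst q, snd p)"]) (auto intro: has_derivative_mu)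
qed (rule mu_equivariant)

section \<open>Nondegeneracy of \<open>omega\<close> on \<open>phase_space\<close>\<close>

lemma subspace_phase_space: "subspace (phase_space :: 'n::finite pair set)"
proof -
  have "subspace (V_lower :: ('n tvec \<Rightarrow>\<^sub>L 'n endo) set)"
  proof (rule subspaceI; rule V_lowerI)
    fix a a' :: "'n tvec \<Rightarrow>\<^sub>L 'n endo" and v w c
    assume "a \<in> V_lower"
    note a = V_lower_skew[OF this, of v w] V_lower_trace[OF this]
    show "(c *\<^sub>R a) v w = - (c *\<^sub>R a) w v" "endo_trace ((c *\<^sub>R a) v) = 0"
      using a by (simp_all add: blinfun.bilinear_simps endo_trace_simps)
    assume "a' \<in> V_lower"
    note a' = V_lower_skew[OF this, of v w] V_lower_trace[OF this]
    show "(a + a') v w = - (a + a') w v" "endo_trace ((a + a') v) = 0"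
      using a a' by (simp_all add: blinfun.bilinear_simps endo_trace_simps)
  qed (auto simp: endo_trace_simps)
  moreover have "subspace (V_upper :: ('n tcovec \<Rightarrow>\<^sub>L 'n endo) set)"
  proof (rule subspaceI; rule V_upperI)
    fix b b' :: "'n tcovec \<Rightarrow>\<^sub>L 'n endo" and \<alpha> \<beta> :: "'n tcovec" and x c
    assume "b \<in> V_upper"
    note b = V_upper_skew[OF this, of \<beta> \<alpha> x] V_upper_trace[OF this]
    show "\<beta> ((c *\<^sub>R b) \<alpha> x) = - \<alpha> ((c *\<^sub>R b) \<beta> x)" "endo_trace ((c *\<^sub>R b) \<alpha>) = 0"
      using b by (simp_all add: blinfun.bilinear_simps endo_trace_simps)
    assume "b' \<in> V_upper"
    note b' = V_upper_skew[OF this, of \<beta> \<alpha> x] V_upper_trace[OF this]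
    show "\<beta> ((b + b') \<alpha> x) = - \<alpha> ((b + b') \<beta> x)" "endo_trace ((b + b') \<alpha>) = 0"
      using b b' by (simp_all add: blinfun.bilinear_simps endo_trace_simps)
  qed (auto simp: endo_trace_simps)
  ultimately show ?thesis unfolding phase_space_def by (rule subspace_Times)
qed

text \<open>The Euclidean adjoint acts on \<open>T\<close> itself, whereas
  \<open>endo_transpose\<close> acts on covectors; in the standard basis it transposes the
  matrix.\<close>

definition endo_adjoint :: "'n::finite endo \<Rightarrow> 'n endo" where
  "endo_adjoint A = Blinfun (adjoint A)"

lemma endo_adjoint_inner: "endo_adjoint A x \<bullet> y = x \<bullet> A y"
proof -
  have "bounded_linear (adjoint A)"
    by (simp add: adjoint_linear[OF linear_endo] linear_conv_bounded_linear[symmetric])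
  then show ?thesis
    by (simp add: endo_adjoint_def bounded_linear_Blinfun_apply adjoint_works[OF linear_endo] inner_commute)
qed

lemma inner_std_basis: "x \<bullet> std_basis k = x $ k" "std_basis k \<bullet> x = x $ k"
  by (auto simp: std_basis_def inner_axis inner_commute)

lemma endo_adjoint_entry: "endo_adjoint A (std_basis k) $ l = A (std_basis l) $ k"
  using endo_adjoint_inner[of A "std_basis k" "std_basis l"] by (simp add: inner_std_basis)

lemma endo_trace_adjoint: "endo_trace (endo_adjoint A) = endo_trace A"
  by (simp add: endo_trace_eq endo_adjoint_entry)

text \<open>\<open>raise_index\<close> and \<open>lower_index\<close> identify \<open>V_lower\<close> and \<open>V_upper\<close> through the Euclidean metric, so
  that the duality of an element with its image is its squared norm.\<close>

definition raise_index :: "('n::finite tvec \<Rightarrow>\<^sub>L 'n endo) \<Rightarrow> ('n tcovec \<Rightarrow>\<^sub>L 'n endo)" where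
  "raise_index a = Blinfun (\<lambda>\<alpha> :: 'n tcovec. \<Sum>j\<in>UNIV. \<alpha> (std_basis j) *\<^sub>R endo_adjoint (a (std_basis j)))"

definition lower_index :: "('n::finite tcovec \<Rightarrow>\<^sub>L 'n endo) \<Rightarrow> ('n tvec \<Rightarrow>\<^sub>L 'n endo)" where
  "lower_index b = Blinfun (\<lambda>v. \<Sum>j\<in>UNIV. (v $ j) *\<^sub>R endo_adjoint (b (dual_basis j)))"

lemma raise_index_apply: "raise_index a \<alpha> = (\<Sum>j\<in>UNIV. blinfun_apply \<alpha> (std_basis j) *\<^sub>R endo_adjoint (a (std_basis j)))"
  unfolding raise_index_def
  by (subst bounded_linear_Blinfun_apply)
    (auto intro!: bounded_linear_sum bounded_linear_scaleR_const blinfun.bounded_linear_left)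

lemma lower_index_apply: "lower_index b v = (\<Sum>j\<in>UNIV. (v $ j) *\<^sub>R endo_adjoint (b (dual_basis j)))"
  unfolding lower_index_def
  by (subst bounded_linear_Blinfun_apply)
    (auto intro!: bounded_linear_sum bounded_linear_scaleR_const bounded_linear_vec_nth)

lemma raise_index_dual_basis: "raise_index a (dual_basis i) = endo_adjoint (a (std_basis i))"
proof -
  have "raise_index a (dual_basis i) = (\<Sum>j\<in>UNIV. if j = i then endo_adjoint (a (std_basis j)) else 0)"
    unfolding raise_index_apply by (rule sum.cong) (auto simp: std_basis_def axis_def)
  then show ?thesis by simp
qed

lemma lower_index_std_basis: "lower_index b (std_basis i) = endo_adjoint (b (dual_basis i))"
proof -
  have "lower_index b (std_basis i) = (\<Sum>j\<in>UNIV. if j = i then endo_adjoint (b (dual_basis j)) else 0)"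
    unfolding lower_index_apply by (rule sum.cong) (auto simp: std_basis_def axis_def)
  then show ?thesis by simp
qed

text \<open>Passing to adjoints turns skewness of \<open>a\<close> in its two arguments into
  skewness between the index j of a_j and the output coordinate, which is the condition on
  \<open>V_upper\<close>. Adjoints preserve the trace.\<close>

lemma raise_index_mem_V_upper:
  fixes a :: "'n::finite tvec \<Rightarrow>\<^sub>L 'n endo"
  assumes a: "a \<in> V_lower"
  shows "raise_index a \<in> V_upper"
proof -
  have e: "\<beta> x = (\<Sum>l\<in>UNIV. x $ l * \<beta> (std_basis l))" for \<beta> :: "'n tcovec" and x
  proof -
    have "\<beta> x = \<beta> (\<Sum>l\<in>UNIV. (x $ l) *\<^sub>R std_basis l)" by (simp add: std_basis_expansion)
    then show ?thesis by (simp add: blinfun.sum_right blinfun.scaleR_right)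
  qed
  have adj: "endo_adjoint (a (std_basis j)) x $ l = - (endo_adjoint (a (std_basis l)) x $ j)" for j l x
  proof -
    have "x \<bullet> a (std_basis j) (std_basis l) = x \<bullet> (- a (std_basis l) (std_basis j))"
      by (subst V_lower_skew[OF a]) simp
    then show ?thesis
      using endo_adjoint_inner[of "a (std_basis j)" x "std_basis l"]
        endo_adjoint_inner[of "a (std_basis l)" x "std_basis j"]
      by (simp add: inner_std_basis)
  qed
  have "\<beta> (raise_index a \<alpha> x) = - \<alpha> (raise_index a \<beta> x)" for \<alpha> \<beta> :: "'n tcovec" and x
  proof -
    have 1: "\<beta> (raise_index a \<alpha> x) = (\<Sum>j\<in>UNIV. \<Sum>l\<in>UNIV. \<alpha> (std_basis j) * \<beta> (std_basis l) * endo_adjoint (a (std_basis j)) x $ l)"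
      for \<alpha> \<beta> :: "'n tcovec"
      by (simp add: raise_index_apply blinfun.bilinear_simps blinfun.sum_left blinfun.sum_right
          e[of \<beta> "endo_adjoint _ _"] sum_distrib_left mult_ac)
    have "\<beta> (raise_index a \<alpha> x) = (\<Sum>l\<in>UNIV. \<Sum>j\<in>UNIV. \<alpha> (std_basis j) * \<beta> (std_basis l) * endo_adjoint (a (std_basis j)) x $ l)"
      unfolding 1 by (rule sum.swap)
    also have "\<dots> = - \<alpha> (raise_index a \<beta> x)"
      unfolding 1[of \<alpha> \<beta>] by (subst adj) (simp add: sum_negf mult_ac)
    finally show ?thesis .
  qed
  moreover have "endo_trace (raise_index a \<alpha>) = 0" for \<alpha>
    using a by (simp add: raise_index_apply endo_trace_simps endo_trace_adjoint V_lower_trace)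
  ultimately show ?thesis by (rule V_upperI)
qed

text \<open>Here skewness between the index of b_j and its output coordinate becomes, after
  adjoints, skewness between index and argument on basis vectors; bilinear expansion extends it to
  all vectors.\<close>

lemma lower_index_mem_V_lower:
  fixes b :: "'n::finite tcovec \<Rightarrow>\<^sub>L 'n endo"
  assumes b: "b \<in> V_upper"
  shows "lower_index b \<in> V_lower"
proof -
  have adj: "endo_adjoint (b (dual_basis j)) (std_basis l) = - endo_adjoint (b (dual_basis l)) (std_basis j)" for j l
    using V_upper_skew[OF b, of "dual_basis l" "dual_basis j"]
    by (simp add: vec_eq_iff endo_adjoint_entry)
  have 1: "lower_index b v w = (\<Sum>j\<in>UNIV. \<Sum>l\<in>UNIV. (v $ j * w $ l) *\<^sub>R endo_adjoint (b (dual_basis j)) (std_basis l))" for v w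
  proof -
    have "lower_index b v w = lower_index b v (\<Sum>l\<in>UNIV. (w $ l) *\<^sub>R std_basis l)" by (simp add: std_basis_expansion)
    also have "\<dots> = (\<Sum>l\<in>UNIV. \<Sum>j\<in>UNIV. (v $ j * w $ l) *\<^sub>R endo_adjoint (b (dual_basis j)) (std_basis l))"
      by (simp add: lower_index_apply blinfun.bilinear_simps blinfun.sum_left blinfun.sum_right scaleR_sum_right mult_ac)
    finally show ?thesis by (subst sum.swap)
  qed
  have "lower_index b v w = - lower_index b w v" for v w
  proof -
    have "lower_index b v w = (\<Sum>l\<in>UNIV. \<Sum>j\<in>UNIV. (v $ j * w $ l) *\<^sub>R endo_adjoint (b (dual_basis j)) (std_basis l))"
      unfolding 1 by (rule sum.swap)
    also have "\<dots> = - lower_index b w v"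
      unfolding 1[of w v] by (subst adj) (simp add: sum_negf mult_ac)
    finally show ?thesis .
  qed
  moreover have "endo_trace (lower_index b v) = 0" for v
    using b by (simp add: lower_index_apply endo_trace_simps endo_trace_adjoint V_upper_trace)
  ultimately show ?thesis by (rule V_lowerI)
qed

text \<open>This trace is the squared Hilbert-Schmidt norm, the sum of the squares of the matrix
  entries.\<close>

lemma endo_trace_adjoint_self:
  "endo_trace (A o\<^sub>L endo_adjoint A) \<ge> 0" "endo_trace (A o\<^sub>L endo_adjoint A) = 0 \<longleftrightarrow> A = 0"
proof -
  have eq: "endo_trace (A o\<^sub>L endo_adjoint A) = (\<Sum>k\<in>UNIV. \<Sum>l\<in>UNIV. (A (std_basis l) $ k)\<^sup>2)"
    by (simp add: endo_trace_compose endo_adjoint_entry power2_eq_square)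
  show "endo_trace (A o\<^sub>L endo_adjoint A) \<ge> 0"
    unfolding eq by (intro sum_nonneg) auto
  have "A = 0" if "\<And>k l. A (std_basis l) $ k = 0"
  proof (rule blinfun_eqI)
    fix x
    have "A x = A (\<Sum>l\<in>UNIV. (x $ l) *\<^sub>R std_basis l)" by (simp add: std_basis_expansion)
    also have "\<dots> = 0" using that
      by (simp add: blinfun.sum_right blinfun.scaleR_right vec_eq_iff)
    finally show "A x = blinfun_apply 0 x" by simp
  qed
  then show "endo_trace (A o\<^sub>L endo_adjoint A) = 0 \<longleftrightarrow> A = 0"
    unfolding eq by (auto simp: sum_nonneg_eq_0_iff sum_nonneg)
qed

lemma duality_raise_index_eq_0:
  assumes "duality a (raise_index a) = 0"
  shows "a = 0"
proof -
  have "a (std_basis i) = 0" for i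
    using assms by (simp add: duality_def raise_index_dual_basis sum_nonneg_eq_0_iff endo_trace_adjoint_self)
  then have "a v = 0" for v
    by (subst std_basis_expansion[symmetric, of v]) (simp add: blinfun.sum_right blinfun.scaleR_right)
  then show ?thesis by (intro blinfun_eqI) simp
qed

lemma duality_lower_index_eq_0:
  assumes "duality (lower_index b) b = 0"
  shows "b = 0"
proof -
  have "b (dual_basis i) = 0" for i
    using assms
    by (simp add: duality_def lower_index_std_basis sum_nonneg_eq_0_iff endo_trace_adjoint_self
        endo_trace_commute[of "endo_adjoint _"])
  then have "b \<alpha> = 0" for \<alpha>
    by (subst dual_basis_expansion[symmetric, of \<alpha>]) (simp add: blinfun.sum_right blinfun.scaleR_right)
  then show ?thesis by (intro blinfun_eqI) simp
qed

text \<open>Testing (a, b) against \<open>(0, raise_index a)\<close> isolates the squared norm of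
  \<open>a\<close>, and testing it against \<open>(lower_index b, 0)\<close> isolates minus that of
  \<open>b\<close>.\<close>

lemma omega_nondegenerate:
  fixes x :: "'n::finite pair"
  assumes x: "x \<in> phase_space" and 0: "\<And>y. y \<in> phase_space \<Longrightarrow> omega p x y = 0"
  shows "x = 0"
proof -
  obtain a b where ab: "x = (a, b)" by (cases x)
  have mem: "a \<in> V_lower" "b \<in> V_upper" using x by (auto simp: ab phase_space_def)
  have z: "0 \<in> V_lower" "0 \<in> V_upper"
    using subspace_0[OF subspace_phase_space] by (auto simp: phase_space_def zero_prod_def)
  have "a = 0"
    using 0[of "(0, raise_index a)"] raise_index_mem_V_upper[OF mem(1)] z
    by (intro duality_raise_index_eq_0) (simp add: phase_space_def omega_def ab duality_zero)
  moreover have "b = 0"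
    using 0[of "(lower_index b, 0)"] lower_index_mem_V_lower[OF mem(2)] z
    by (intro duality_lower_index_eq_0) (simp add: phase_space_def omega_def ab duality_zero)
  ultimately show ?thesis by (simp add: ab zero_prod_def)
qed

theorem proposition3p5:
  shows "constant_symplectic_form_on phase_space (omega :: 'n::finite pair \<Rightarrow> 'n pair \<Rightarrow> 'n pair \<Rightarrow> real) \<and>
    is_moment_map phase_space act_pair omega (mu :: 'n pair \<Rightarrow> 'n endo) \<and>
    (\<forall>a\<in>V_lower. \<forall>b\<in>V_upper. \<forall>X :: 'n endo.
       gl_pairing (mu (a, b)) X = duality (infinitesimal act_lower X a) b)"
proof (intro conjI is_moment_map_mu)
  show "constant_symplectic_form_on phase_space (omega :: 'n pair \<Rightarrow> 'n pair \<Rightarrow> 'n pair \<Rightarrow> real)"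
    unfolding constant_symplectic_form_on_def
  proof (intro conjI subspace_phase_space ballI allI impI)
    fix p x :: "'n pair"
    assume "x \<in> phase_space" "\<forall>y\<in>phase_space. omega p x y = 0"
    then show "x = 0" by (intro omega_nondegenerate) auto
  \<comment> \<open>What is left is constancy in the base point, linearity and antisymmetry, all
    read off from the formula for \<open>omega\<close> and the bilinearity of the duality.\<close>
  qed (auto simp: omega_def duality_add duality_scaleR algebra_simps)
qed (simp add: gl_pairing_mu infinitesimal_act_lower)

end
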